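(* $f(k,k^2)\sim k^2$ as $k\to\infty$, i.e. $$\lim_{k\to\infty}\frac{f(k,k^2)}{k^2}=1,$$ where $k$ ranges over the positive integers.
   Context: Let $k,N$ be positive integers and let $A,B$ be disjoint sets with $|A|=|B|=N$. For $S\subset A\cup B$ write $S_A=S\cap A$ and $S_B=S\cap B$. A family $\mathcal{S}$ of subsets of $A\cup B$ is called semiintersecting (with constants $k$ and $N$) if (i) $|S_A|=|S_B|=k$ for all $S\in\mathcal{S}$, and (ii) for all $S\neq T$ in $\mathcal{S}$, $S_A\cap T_A=\emptyset$ if and only if $S_B\cap T_B\neq\emptyset$. Define $f(k,N)$ to be the maximum of $|\mathcal{S}|$ over all semiintersecting families $\mathcal{S}$ with constants $k$ and $N$. *)

theory Defs
  imports Complex_Main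
begin

definition semiintersecting :: "nat \<Rightarrow> nat \<Rightarrow> 'a set \<Rightarrow> 'a set \<Rightarrow> 'a set set \<Rightarrow> bool" where
  "semiintersecting k N A B \<S> \<longleftrightarrow>
     finite A \<and> finite B \<and> card A = N \<and> card B = N \<and> A \<inter> B = {} \<and>
     \<S> \<subseteq> Pow (A \<union> B) \<and>
     (\<forall>S\<in>\<S>. card (S \<inter> A) = k \<and> card (S \<inter> B) = k) \<and>
     (\<forall>S\<in>\<S>. \<forall>T\<in>\<S>. S \<noteq> T \<longrightarrow>
        ((S \<inter> A) \<inter> (T \<inter> A) = {} \<longleftrightarrow> (S \<inter> B) \<inter> (T \<inter> B) \<noteq> {}))"

(* The maximum does not depend on the choice of the ground sets A and B, so they are
   taken among the finite sets of natural numbers. *)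

definition semiintersecting_sizes :: "nat \<Rightarrow> nat \<Rightarrow> nat set" where
  "semiintersecting_sizes k N =
     {card \<S> | (A :: nat set) B \<S>. semiintersecting k N A B \<S>}"

definition max_semiintersecting :: "nat \<Rightarrow> nat \<Rightarrow> nat" where
  "max_semiintersecting k N = Max (semiintersecting_sizes k N)"

(* The two facts below ensure that Max is applied to a finite nonempty set. *)

lemma finite_semiintersecting_sizes: "finite (semiintersecting_sizes k N)"
proof (rule finite_subset)
  show "semiintersecting_sizes k N \<subseteq> {..2 ^ (2 * N)}"
  proof
    fix n assume "n \<in> semiintersecting_sizes k N"
    then obtain A B :: "nat set" and \<S>
      where n: "n = card \<S>" and s: "semiintersecting k N A B \<S>"
      unfolding semiintersecting_sizes_def by blast
    have fin: "finite (A \<union> B)" and sub: "\<S> \<subseteq> Pow (A \<union> B)" and c: "card (A \<union> B) = 2 * N"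
      using s by (auto simp: semiintersecting_def card_Un_disjoint)
    have "card \<S> \<le> card (Pow (A \<union> B))"
      using fin sub by (intro card_mono) auto
    also have "\<dots> = 2 ^ (2 * N)"
      using fin c by (simp add: card_Pow)
    finally show "n \<in> {..2 ^ (2 * N)}"
      using n by simp
  qed
qed simp

lemma semiintersecting_sizes_nonempty: "semiintersecting_sizes k N \<noteq> {}"
proof -
  have "semiintersecting k N {..<N} {N..<2 * N} {}"
    by (auto simp: semiintersecting_def)
  then show ?thesis
    unfolding semiintersecting_sizes_def by blast
qed

end

theory Submission
  imports
    Defs
    "HOL-Analysis.Kronecker_Approximation_Theorem"
    "HOL-Algebra.Algebraic_Closure_Type"
    "HOL-Number_Theory.Residues"
begin

text \<open>
  Write $f(k)$ for the maximum with $N = k^2$. The upper bound $f(k) \le k^2$ is a double count: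
  the sets of a semiintersecting family that contain a given point of \<open>A\<close> meet pairwise in \<open>A\<close>, so
  their \<open>B\<close>-parts are pairwise disjoint $k$-subsets of a set of size $k^2$, and there are at most $k$
  of them; summing over \<open>A\<close> gives $k \cdot |\mathcal S| \le k^2 \cdot k$.

  For the lower bound, the natural first idea is an affine plane of prime power order $q$: on the \<open>B\<close>
  side a member is a line with slope $c$ and intercept $l$, where lines are disjoint precisely when
  $c = c'$ and $l \ne l'$, and on the \<open>A\<close> side it is a block depending on $c$ only. This
  settles $k = q$, but reaching every $k$ would need a prime power in each interval
  $[(1 - \varepsilon) k, k]$ with $k$ large, a fact of the depth of the prime number theorem. The
  point of the proof below is that the \<open>A\<close> side of this example is very wasteful, and that the waste
  pays for a product of two planes, of orders $q$ and $r$, provided that $q + 2 \le r \le q^2$.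

  A member of the product family is given by a line $(c, l)$ of the first plane and a line $(d, m)$ of
  the second one. Its \<open>B\<close>-part is the product of the two lines, so two members are disjoint in \<open>B\<close> iff
    (D)  either $c = c'$ and $l \ne l'$, or $d = d'$ and $m \ne m'$ (or both).
  The \<open>A\<close>-part must cover just the pairs with (D). A point of \<open>A\<close> is a pair $(c, \varphi)$ with
  $\varphi$ a function from intercepts of the first plane to slopes of the second one; it lies
  in the members with slope $c$ and $\varphi(l) = d$. Any two of these satisfy (D): if the
  intercepts $l$ agree then so do the slopes $d$. All pairs of the first kind are covered once
  the functions $\varphi$ in use take every pair of values at every pair of distinct arguments, that is,
  form a covering array of strength two; affine functions over the field of order $r$ do, and each
  member then has $r$ such points. The pairs of the second kind are
  covered in the same way by functions from $r$ intercepts to $q$ slopes; as $r > q$, these are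
  affine functions of two variables over the field of order $q$, and each member has $q^2$ such
  points. The total $r + q^2$ is at most $q r$ because $r \ge q + 2$. Dummy points bring all sizes up
  to any prescribed $k \ge q r$, and a count shows that $k^2$ points suffice on each side. Hence
  $f(k) \ge (q r)^2$ (\<open>square_le_max_semiintersecting_fields\<close>).

  It remains to take $q = 2^a$ and $r = 3^b$. Since $\log_2 3$ is irrational, such products occur in
  $[(1 - \varepsilon) k, k]$ for all large $k$, even with $q + 2 \le r \le q^2$
  (\<open>eventually_near_2_power_times_3_power\<close>).
\<close>

section \<open>The upper bound\<close>

text \<open>
  At most \<open>k\<close> members contain a given point of \<open>A\<close>, as their traces on \<open>B\<close> are disjoint \<open>k\<close>-sets.
  Counting incidences with \<open>A\<close> turns this bound on degrees into one on the size of the family.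
\<close>

lemma max_semiintersecting_le:
  assumes "k > 0"
  shows "max_semiintersecting k (k\<^sup>2) \<le> k\<^sup>2"
proof -
  have "card \<S> \<le> k\<^sup>2" if s: "semiintersecting k (k\<^sup>2) A B \<S>" for A B :: "nat set" and \<S>
  proof -
    have fin: "finite A" "finite B" and AB: "card A = k\<^sup>2" "card B = k\<^sup>2"
      and kA: "\<And>S. S \<in> \<S> \<Longrightarrow> card (S \<inter> A) = k" and kB: "\<And>S. S \<in> \<S> \<Longrightarrow> card (S \<inter> B) = k"
      and ST: "\<And>S T. S \<in> \<S> \<Longrightarrow> T \<in> \<S> \<Longrightarrow> S \<noteq> T \<Longrightarrow>
         (S \<inter> A) \<inter> (T \<inter> A) = {} \<longleftrightarrow> (S \<inter> B) \<inter> (T \<inter> B) \<noteq> {}"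
      using s unfolding semiintersecting_def by auto
    have "\<S> \<subseteq> Pow (A \<union> B)" using s unfolding semiintersecting_def by auto
    then have finS: "finite \<S>" using fin finite_subset by blast
    have deg: "card {S\<in>\<S>. x \<in> S} \<le> k" if "x \<in> A" for x
    proof -
      define D where "D = {S\<in>\<S>. x \<in> S}"
      have "card D * k = (\<Sum>S\<in>D. card (S \<inter> B))"
        using kB by (simp add: D_def)
      also have "\<dots> = card (\<Union>S\<in>D. S \<inter> B)"
        using ST that finS fin by (intro card_UN_disjoint [symmetric]) (auto simp: D_def)
      also have "\<dots> \<le> card B" using fin by (intro card_mono) auto
      finally have "card D * k \<le> k * k" using AB by (simp add: power2_eq_square)
      then show ?thesis using \<open>k > 0\<close> unfolding D_def by simp
    qed
    have "card \<S> * k = (\<Sum>S\<in>\<S>. card (S \<inter> A))" using kA by simp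
    also have "\<dots> = (\<Sum>S\<in>\<S>. \<Sum>x\<in>A. if x \<in> S then 1 else 0)"
      using fin by (intro sum.cong) (auto simp: sum.If_cases Int_commute)
    also have "\<dots> = (\<Sum>x\<in>A. \<Sum>S\<in>\<S>. if x \<in> S then 1 else 0)" by (rule sum.swap)
    also have "\<dots> = (\<Sum>x\<in>A. card {S\<in>\<S>. x \<in> S})"
      using finS by (intro sum.cong) (auto simp: sum.If_cases Int_def)
    also have "\<dots> \<le> (\<Sum>x\<in>A. k)" using deg by (intro sum_mono)
    finally show ?thesis using AB \<open>k > 0\<close> by simp
  qed
  then show ?thesis
    unfolding max_semiintersecting_def
    using finite_semiintersecting_sizes semiintersecting_sizes_nonempty
    by (subst Max_le_iff) (auto simp: semiintersecting_sizes_def)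
qed

section \<open>Covering arrays\<close>

text \<open>
  Covering arrays of strength two: the rows \<open>R\<close> are functions from columns \<open>C\<close> to levels \<open>L\<close>, and any
  two columns show every pair of levels. They are also balanced, each level occurring exactly
  \<open>t\<close> times in every column, because all members of the families below must have the same size.
\<close>

definition covering_array :: "'r set \<Rightarrow> 'c set \<Rightarrow> 'l set \<Rightarrow> nat \<Rightarrow> ('r \<Rightarrow> 'c \<Rightarrow> 'l) \<Rightarrow> bool" where
  "covering_array R C L t f \<longleftrightarrow>
     finite R \<and> (\<forall>\<rho>\<in>R. \<forall>x\<in>C. f \<rho> x \<in> L) \<and>
     (\<forall>x\<in>C. \<forall>a\<in>L. card {\<rho>\<in>R. f \<rho> x = a} = t) \<and>
     (\<forall>x\<in>C. \<forall>y\<in>C. x \<noteq> y \<longrightarrow> (\<forall>a\<in>L. \<forall>b\<in>L. \<exists>\<rho>\<in>R. f \<rho> x = a \<and> f \<rho> y = b))"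

lemma covering_array_cover:
  assumes "covering_array R C L t f" "x \<in> C" "y \<in> C" "x \<noteq> y" "a \<in> L" "b \<in> L"
  shows "\<exists>\<rho>\<in>R. f \<rho> x = a \<and> f \<rho> y = b"
  using assms unfolding covering_array_def by blast

lemma covering_array_card:
  assumes "covering_array R C L t f" "x \<in> C" "a \<in> L"
  shows "card {\<rho>\<in>R. f \<rho> x = a} = t"
  using assms unfolding covering_array_def by blast

lemma card_rows_covering_array:
  assumes ca: "covering_array R C L t f" and "C \<noteq> {}" "finite L"
  shows "card R = card L * t"
proof -
  obtain x where x: "x \<in> C" using assms by auto
  have "R = (\<Union>a\<in>L. {\<rho>\<in>R. f \<rho> x = a})"
    using ca x unfolding covering_array_def by auto
  also have "card \<dots> = (\<Sum>a\<in>L. card {\<rho>\<in>R. f \<rho> x = a})"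
    using ca assms(3) by (intro card_UN_disjoint) (auto simp: covering_array_def)
  also have "\<dots> = card L * t"
    using ca x by (simp add: covering_array_def)
  finally show ?thesis .
qed

text \<open>
  Columns may be dropped and renamed, so only their number matters; this is how one transfers
  between two fields that have nothing else to do with each other.
\<close>

lemma covering_array_columns:
  assumes ca: "covering_array R C L t f" and "inj_on g C'" "g ` C' \<subseteq> C"
  shows "covering_array R C' L t (\<lambda>\<rho> x. f \<rho> (g x))"
proof -
  have "g x \<noteq> g y" if "x \<in> C'" "y \<in> C'" "x \<noteq> y" for x y
    using that assms(2) by (auto dest: inj_onD)
  moreover have "g x \<in> C" if "x \<in> C'" for x using that assms(3) by auto
  ultimately show ?thesis using ca unfolding covering_array_def by simp
qed

text \<open>
  This is the dual view in which rows are points, columns are parallel classes and levels number the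
  blocks of a class: blocks are disjoint just when they are different blocks of one class.
\<close>

lemma covering_array_disjoint_iff:
  assumes ca: "covering_array R C L t f" and xy: "x \<in> C" "y \<in> C" and ab: "a \<in> L" "b \<in> L" and "t > 0"
  shows "{\<rho>\<in>R. f \<rho> x = a} \<inter> {\<rho>\<in>R. f \<rho> y = b} = {} \<longleftrightarrow> x = y \<and> a \<noteq> b"
proof (cases "x = y")
  case True
  have "{\<rho>\<in>R. f \<rho> x = a} \<noteq> {}"
    using covering_array_card[OF ca xy(1) ab(1)] \<open>t > 0\<close> by (metis card.empty less_irrefl)
  then show ?thesis using True by auto
next
  case False
  then show ?thesis using covering_array_cover[OF ca xy False ab] by auto
qed


section \<open>The product of two affine planes\<close>

(* In this theory the symbol denotes the disjoint sum of sets only. *)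
no_notation set_add (infixl \<open><+>\<index>\<close> 60)

lemma Plus_Int_Plus: "(A <+> B) \<inter> (C <+> D) = (A \<inter> C) <+> (B \<inter> D)"
  by auto

text \<open>
  The interface for constructions: the two ground sets may have any types and may be too small, and
  the members are given by an index. Members with different indices are automatically different,
  since equal ones would meet on both sides.
\<close>

lemma card_le_max_semiintersecting:
  fixes P :: "'i \<Rightarrow> 'a set" and Q :: "'i \<Rightarrow> 'b set"
  assumes "k > 0" and U: "finite U" "card U \<le> N" and V: "finite V" "card V \<le> N"
    and P: "\<And>i. i \<in> I \<Longrightarrow> P i \<subseteq> U \<and> card (P i) = k"
    and Q: "\<And>i. i \<in> I \<Longrightarrow> Q i \<subseteq> V \<and> card (Q i) = k"
    and PQ: "\<And>i j. i \<in> I \<Longrightarrow> j \<in> I \<Longrightarrow> i \<noteq> j \<Longrightarrow> P i \<inter> P j = {} \<longleftrightarrow> Q i \<inter> Q j \<noteq> {}"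
  shows "card I \<le> max_semiintersecting k N"
proof -
  obtain f :: "'a \<Rightarrow> nat" where f: "inj_on f U" "f ` U \<subseteq> {..<N}"
    using card_le_inj[of U "{..<N}"] U by auto
  obtain g :: "'b \<Rightarrow> nat" where g: "inj_on g V" "g ` V \<subseteq> {N..<2 * N}"
    using card_le_inj[of V "{N..<2 * N}"] V by auto
  define S where "S = (\<lambda>i. f ` P i \<union> g ` Q i)"
  have SA: "S i \<inter> {..<N} = f ` P i" and SB: "S i \<inter> {N..<2 * N} = g ` Q i"
    and Ssub: "S i \<subseteq> {..<N} \<union> {N..<2 * N}" if "i \<in> I" for i
  proof -
    have "f ` P i \<subseteq> {..<N}" "g ` Q i \<subseteq> {N..<2 * N}"
      using P[OF that] Q[OF that] f g by blast+
    then show "S i \<inter> {..<N} = f ` P i" "S i \<inter> {N..<2 * N} = g ` Q i"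
      "S i \<subseteq> {..<N} \<union> {N..<2 * N}"
      unfolding S_def by auto
  qed
  have fI: "f ` P i \<inter> f ` P j = f ` (P i \<inter> P j)" if "i \<in> I" "j \<in> I" for i j
    using inj_on_image_Int[OF f(1)] P that by auto
  have gI: "g ` Q i \<inter> g ` Q j = g ` (Q i \<inter> Q j)" if "i \<in> I" "j \<in> I" for i j
    using inj_on_image_Int[OF g(1)] Q that by auto
  have cf: "card (f ` P i) = k" if "i \<in> I" for i
    using card_image[of f "P i"] inj_on_subset[OF f(1)] P[OF that] by auto
  have cg: "card (g ` Q i) = k" if "i \<in> I" for i
    using card_image[of g "Q i"] inj_on_subset[OF g(1)] Q[OF that] by auto
  have inj: "inj_on S I"
  proof (rule inj_onI, rule ccontr)
    fix i j assume ij: "i \<in> I" "j \<in> I" "S i = S j" "i \<noteq> j"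
    have "f ` P i \<inter> f ` P j \<noteq> {}"
      using SA[OF ij(1)] SA[OF ij(2)] cf[OF ij(1)] ij(3) \<open>k > 0\<close> by fastforce
    moreover have "g ` Q i \<inter> g ` Q j \<noteq> {}"
      using SB[OF ij(1)] SB[OF ij(2)] cg[OF ij(1)] ij(3) \<open>k > 0\<close> by fastforce
    ultimately show False using PQ[OF ij(1,2,4)] fI[OF ij(1,2)] gI[OF ij(1,2)] by auto
  qed
  have "semiintersecting k N {..<N} {N..<2 * N} (S ` I)"
    unfolding semiintersecting_def
  proof (intro conjI ballI impI)
    fix E E' assume "E \<in> S ` I" "E' \<in> S ` I" "E \<noteq> E'"
    then obtain i j where ij: "i \<in> I" "j \<in> I" "i \<noteq> j" "E = S i" "E' = S j" by auto
    show "E \<inter> {..<N} \<inter> (E' \<inter> {..<N}) = {} \<longleftrightarrow> E \<inter> {N..<2 * N} \<inter> (E' \<inter> {N..<2 * N}) \<noteq> {}"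
      unfolding ij(4,5) SA[OF ij(1)] SA[OF ij(2)] SB[OF ij(1)] SB[OF ij(2)] fI[OF ij(1,2)] gI[OF ij(1,2)]
      using PQ[OF ij(1-3)] by simp
  next
    show "S ` I \<subseteq> Pow ({..<N} \<union> {N..<2 * N})" using Ssub by blast
  qed (use SA SB cf cg in auto)
  then have "card (S ` I) \<in> semiintersecting_sizes k N"
    unfolding semiintersecting_sizes_def by blast
  then show ?thesis
    unfolding max_semiintersecting_def card_image[OF inj]
    by (intro Max_ge finite_semiintersecting_sizes)
qed

text \<open>
  The product construction. The rows of the first two arrays are the points of two affine planes
  with parallel classes \<open>c\<close>, \<open>d\<close> and lines \<open>l\<close>, \<open>m\<close> in them, and a member is a pair of lines. The set
  \<open>Q\<close> is the product of the two lines. The set \<open>P\<close> has a point for each \<open>\<phi>\<close> with \<open>\<phi> l = d\<close>, tagged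
  by \<open>c\<close>, and for each \<open>\<psi>\<close> with \<open>\<psi> m = c\<close>, tagged by \<open>d\<close>.

  Dummy points are shared by all members with a common pair \<open>(c, d)\<close> on one side, and with a common
  pair \<open>(l, m)\<close> on the other. They add no intersection that is not wanted: distinct members with
  the same \<open>c\<close> and \<open>d\<close> differ in \<open>l\<close> or in \<open>m\<close>, so they have to meet in \<open>P\<close>, and members with the same
  \<open>l\<close> and \<open>m\<close> have to meet in \<open>Q\<close>. Separate dummy points for each
  member would make the ground sets too large in general.
\<close>

lemma square_le_max_semiintersecting:
  fixes F :: "'f set" and H :: "'h set"
  assumes "card F > 0" "card H > 0"
    and F: "covering_array R\<^sub>F F F (card F) f" and H: "covering_array R\<^sub>H H H (card H) h"
    and FH: "covering_array \<Phi> F H t \<phi>" and HF: "covering_array \<Psi> H F s \<psi>"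
    and ts: "t + s \<le> k" and k: "card F * card H \<le> k"
  shows "(card F * card H)\<^sup>2 \<le> max_semiintersecting k (k\<^sup>2)"
proof -
  define q r where qr: "q = card F" "r = card H"
  have pos: "q > 0" "r > 0" using assms qr by auto
  have fin: "finite F" "finite H" using assms card_gt_0_iff by blast+
  have ne: "F \<noteq> {}" "H \<noteq> {}" using assms by auto
  have finR: "finite R\<^sub>F" "finite R\<^sub>H" "finite \<Phi>" "finite \<Psi>"
    using F H FH HF by (auto simp: covering_array_def)
  have cR: "card R\<^sub>F = q * q" "card R\<^sub>H = r * r" "card \<Phi> = r * t" "card \<Psi> = q * s"
    using card_rows_covering_array[OF F] card_rows_covering_array[OF H]
      card_rows_covering_array[OF FH] card_rows_covering_array[OF HF] fin ne by (auto simp: qr)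
  define I where "I = (F \<times> F) \<times> (H \<times> H)"
  define P where "P = (\<lambda>((c, l), (d, m)).
     ({c} \<times> {\<rho>\<in>\<Phi>. \<phi> \<rho> l = d}) <+>
     ({d} \<times> {\<rho>\<in>\<Psi>. \<psi> \<rho> m = c}) <+> ({(c, d)} \<times> {..<k - (t + s)}))"
  define Q where "Q = (\<lambda>((c, l), (d, m)).
     ({\<rho>\<in>R\<^sub>F. f \<rho> c = l} \<times> {\<rho>\<in>R\<^sub>H. h \<rho> d = m}) <+> ({(l, m)} \<times> {..<k - q * r}))"
  define U where "U = (F \<times> \<Phi>) <+> (H \<times> \<Psi>) <+> ((F \<times> H) \<times> {..<k - (t + s)})"
  define V where "V = (R\<^sub>F \<times> R\<^sub>H) <+> ((F \<times> H) \<times> {..<k - q * r})"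
  have "card I \<le> max_semiintersecting k (k\<^sup>2)"
  proof (rule card_le_max_semiintersecting)
    show "k > 0" using k pos qr by (metis gr0I le_zero_eq mult_eq_0_iff)
    have qrk: "q * r * k \<le> k\<^sup>2" using k qr by (simp add: power2_eq_square)
    show "finite U" unfolding U_def using fin finR by auto
    \<comment> \<open>Both ground sets have exactly \<open>q * r * k\<close> points: every point lies in \<open>q * r\<close> members,
      and there are \<open>(q * r)\<^sup>2\<close> members of size \<open>k\<close>.\<close>
    have "card U = q * (r * t) + (r * (q * s) + q * r * (k - (t + s)))"
      unfolding U_def using fin finR by (simp add: card_Plus card_cartesian_product cR qr)
    also have "\<dots> = q * r * ((t + s) + (k - (t + s)))" by (simp only: algebra_simps)
    also have "\<dots> = q * r * k" using ts by simp
    finally show "card U \<le> k\<^sup>2" using qrk by simp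
    show "finite V" unfolding V_def using fin finR by auto
    have "card V = (q * q) * (r * r) + q * r * (k - q * r)"
      unfolding V_def using fin finR by (simp add: card_Plus card_cartesian_product cR qr)
    also have "\<dots> = q * r * (q * r + (k - q * r))" by (simp only: algebra_simps)
    also have "\<dots> = q * r * k" using k qr by simp
    finally show "card V \<le> k\<^sup>2" using qrk by simp
  next
    fix i assume "i \<in> I"
    obtain c l d m where i: "i = ((c, l), (d, m))" by (metis surj_pair)
    have mem: "c \<in> F" "l \<in> F" "d \<in> H" "m \<in> H" using \<open>i \<in> I\<close> unfolding i I_def by auto
    have cards: "card {\<rho>\<in>\<Phi>. \<phi> \<rho> l = d} = t" "card {\<rho>\<in>\<Psi>. \<psi> \<rho> m = c} = s"
      "card {\<rho>\<in>R\<^sub>F. f \<rho> c = l} = q" "card {\<rho>\<in>R\<^sub>H. h \<rho> d = m} = r"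
      using covering_array_card[OF FH mem(2,3)] covering_array_card[OF HF mem(4,1)]
        covering_array_card[OF F mem(1,2)] covering_array_card[OF H mem(3,4)] by (simp_all add: qr)
    have "card (P i) = t + (s + (k - (t + s)))"
      unfolding i P_def using finR by (simp add: card_Plus card_cartesian_product cards)
    moreover have "P i \<subseteq> U"
      unfolding i P_def U_def prod.case using mem by auto
    ultimately show "P i \<subseteq> U \<and> card (P i) = k" using ts by simp
    have "card (Q i) = q * r + (k - q * r)"
      unfolding i Q_def using finR by (simp add: card_Plus card_cartesian_product cards)
    moreover have "Q i \<subseteq> V"
      unfolding i Q_def V_def prod.case using mem by auto
    ultimately show "Q i \<subseteq> V \<and> card (Q i) = k" using k qr by simp
  next
    fix i j assume I: "i \<in> I" "j \<in> I" and ij: "i \<noteq> j"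
    obtain c l d m c' l' d' m' where ij_eq: "i = ((c, l), (d, m))" "j = ((c', l'), (d', m'))"
      by (metis surj_pair)
    have i: "i = ((c, l), (d, m))" "c \<in> F" "l \<in> F" "d \<in> H" "m \<in> H"
      and j: "j = ((c', l'), (d', m'))" "c' \<in> F" "l' \<in> F" "d' \<in> H" "m' \<in> H"
      using I unfolding ij_eq I_def by auto
    have coverF: "{\<rho>\<in>R\<^sub>F. f \<rho> c = l} \<inter> {\<rho>\<in>R\<^sub>F. f \<rho> c' = l'} = {} \<longleftrightarrow> c = c' \<and> l \<noteq> l'"
      by (rule covering_array_disjoint_iff[OF F i(2) j(2) i(3) j(3)]) (use assms in simp)
    have coverH: "{\<rho>\<in>R\<^sub>H. h \<rho> d = m} \<inter> {\<rho>\<in>R\<^sub>H. h \<rho> d' = m'} = {} \<longleftrightarrow> d = d' \<and> m \<noteq> m'"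
      by (rule covering_array_disjoint_iff[OF H i(4) j(4) i(5) j(5)]) (use assms in simp)
    have pair: "{(u, v)} \<inter> {(u', v')} = {} \<longleftrightarrow> u \<noteq> u' \<or> v \<noteq> v'" for u u' :: 'x and v v' :: 'y
      by auto
    have "Q i \<inter> Q j = {} \<longleftrightarrow> (c = c' \<and> l \<noteq> l') \<or> (d = d' \<and> m \<noteq> m')"
      unfolding i(1) j(1) Q_def prod.case Plus_Int_Plus Times_Int_Times Plus_eq_empty_conv
        Times_empty coverF coverH pair by auto
    moreover have "P i \<inter> P j = {} \<longleftrightarrow> \<not> ((c = c' \<and> l \<noteq> l') \<or> (d = d' \<and> m \<noteq> m'))"
    proof -
      define M where "M = {\<rho>\<in>\<Phi>. \<phi> \<rho> l = d} \<inter> {\<rho>\<in>\<Phi>. \<phi> \<rho> l' = d'}"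
      define M' where "M' = {\<rho>\<in>\<Psi>. \<psi> \<rho> m = c} \<inter> {\<rho>\<in>\<Psi>. \<psi> \<rho> m' = c'}"
      have M: "M = {} \<longrightarrow> l = l'" "l = l' \<and> d \<noteq> d' \<longrightarrow> M = {}"
        using covering_array_cover[OF FH i(3) j(3) _ i(4) j(4)] by (auto simp: M_def)
      have M': "M' = {} \<longrightarrow> m = m'" "m = m' \<and> c \<noteq> c' \<longrightarrow> M' = {}"
        using covering_array_cover[OF HF i(5) j(5) _ i(2) j(2)] by (auto simp: M'_def)
      have single: "{u} \<inter> {u'} = {} \<longleftrightarrow> u \<noteq> u'" for u u' :: 'x by auto
      have diff: "\<not> (c = c' \<and> l = l' \<and> d = d' \<and> m = m')" using ij unfolding i(1) j(1) by simp
      show ?thesis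
        unfolding i(1) j(1) P_def prod.case Plus_Int_Plus Times_Int_Times Plus_eq_empty_conv
          Times_empty single prod.inject M_def [symmetric] M'_def [symmetric]
        using M M' diff by argo
    qed
    ultimately show "P i \<inter> P j = {} \<longleftrightarrow> Q i \<inter> Q j \<noteq> {}" by simp
  qed
  then show ?thesis by (simp add: I_def card_cartesian_product power2_eq_square qr algebra_simps)
qed

section \<open>Covering arrays over finite fields\<close>

definition finite_subfield :: "'a::field set \<Rightarrow> bool" where
  "finite_subfield K \<longleftrightarrow> finite K \<and> 0 \<in> K \<and> 1 \<in> K \<and>
     (\<forall>x\<in>K. \<forall>y\<in>K. x + y \<in> K \<and> x - y \<in> K \<and> x * y \<in> K \<and> x / y \<in> K)"

text \<open>
  Adding constants to the rows of a matrix turns it into a covering array as soon as the difference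
  of any two of its columns takes every value: the difference of the two prescribed levels selects
  the row, and then the constant is determined.
\<close>

lemma covering_array_difference_matrix:
  fixes K :: "'a::field set"
  assumes K: "finite_subfield K" and "finite G"
    and e: "\<And>g x. g \<in> G \<Longrightarrow> x \<in> C \<Longrightarrow> e g x \<in> K"
    and diff: "\<And>x y a. x \<in> C \<Longrightarrow> y \<in> C \<Longrightarrow> x \<noteq> y \<Longrightarrow> a \<in> K \<Longrightarrow> \<exists>g\<in>G. e g x - e g y = a"
  shows "covering_array (G \<times> K) C K (card G) (\<lambda>(g, v) x. e g x + v)"
  unfolding covering_array_def
proof (intro conjI ballI impI)
  show "finite (G \<times> K)" using assms by (auto simp: finite_subfield_def)
next
  fix \<rho> x assume "\<rho> \<in> G \<times> K" "x \<in> C"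
  then show "(case \<rho> of (g, v) \<Rightarrow> \<lambda>x. e g x + v) x \<in> K"
    using K e by (auto simp: finite_subfield_def)
next
  fix x a assume "x \<in> C" "a \<in> K"
  then have "{\<rho> \<in> G \<times> K. (case \<rho> of (g, v) \<Rightarrow> \<lambda>x. e g x + v) x = a} = (\<lambda>g. (g, a - e g x)) ` G"
    using K e by (auto simp: finite_subfield_def image_iff algebra_simps)
  then show "card {\<rho> \<in> G \<times> K. (case \<rho> of (g, v) \<Rightarrow> \<lambda>x. e g x + v) x = a} = card G"
    by (simp add: card_image inj_on_def)
next
  fix x y a b assume *: "x \<in> C" "y \<in> C" "x \<noteq> y" "a \<in> K" "b \<in> K"
  then have "a - b \<in> K" using K by (auto simp: finite_subfield_def)
  then obtain g where g: "g \<in> G" "e g x - e g y = a - b" using diff * by blast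
  have "a - e g x \<in> K" using K e g * by (auto simp: finite_subfield_def)
  moreover have "e g x + (a - e g x) = a" "e g y + (a - e g x) = b" using g(2) by (auto simp: algebra_simps)
  ultimately show "\<exists>\<rho>\<in>G \<times> K. (case \<rho> of (g, v) \<Rightarrow> \<lambda>x. e g x + v) x = a \<and> (case \<rho> of (g, v) \<Rightarrow> \<lambda>x. e g x + v) y = b"
    using g(1) by force
qed

text \<open>
  Read as an array, this is the set of affine functions of one variable. Read dually, the row
  \<open>(g, v)\<close> is a point of the affine plane, and level \<open>a\<close> in column \<open>x\<close> is the line
  \<open>v = a - g * x\<close> of slope \<open>- x\<close>; vertical lines do not occur.
\<close>

lemma covering_array_line:
  assumes K: "finite_subfield K"
  shows "covering_array (K \<times> K) K K (card K) (\<lambda>(g, v) x. g * x + v)"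
proof (rule covering_array_difference_matrix[OF K])
  fix x y a assume *: "x \<in> K" "y \<in> K" "x \<noteq> y" "a \<in> K"
  then have "a / (x - y) \<in> K" using K by (auto simp: finite_subfield_def)
  moreover have "a / (x - y) * x - a / (x - y) * y = a"
    using * unfolding right_diff_distrib [symmetric] by simp
  ultimately show "\<exists>g\<in>K. g * x - g * y = a" by blast
qed (use K in \<open>auto simp: finite_subfield_def\<close>)

text \<open>
  Affine functions of two variables serve many more columns than there are levels, at the price of a
  larger balance.
\<close>

lemma covering_array_plane:
  assumes K: "finite_subfield K"
  shows "covering_array ((K \<times> K) \<times> K) (K \<times> K) K ((card K)\<^sup>2)
           (\<lambda>(g, v) x. (fst g * fst x + snd g * snd x) + v)"
proof -
  have "covering_array ((K \<times> K) \<times> K) (K \<times> K) K (card (K \<times> K))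
           (\<lambda>(g, v) x. (fst g * fst x + snd g * snd x) + v)"
  proof (rule covering_array_difference_matrix[OF K])
    fix x y and a :: 'a assume *: "x \<in> K \<times> K" "y \<in> K \<times> K" "x \<noteq> y" "a \<in> K"
    show "\<exists>g\<in>K \<times> K. (fst g * fst x + snd g * snd x) - (fst g * fst y + snd g * snd y) = a"
    proof (cases "fst x = fst y")
      case False
      then have "(a / (fst x - fst y), 0) \<in> K \<times> K"
        using K * by (auto simp: finite_subfield_def mem_Times_iff)
      moreover have "a / (fst x - fst y) * fst x - a / (fst x - fst y) * fst y = a"
        using False unfolding right_diff_distrib [symmetric] by simp
      ultimately show ?thesis by (intro bexI[of _ "(a / (fst x - fst y), 0)"]) auto
    next
      case True
      then have ne: "snd x \<noteq> snd y" using * by (auto simp: prod_eq_iff)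
      then have "(0, a / (snd x - snd y)) \<in> K \<times> K"
        using K * by (auto simp: finite_subfield_def mem_Times_iff)
      moreover have "a / (snd x - snd y) * snd x - a / (snd x - snd y) * snd y = a"
        using ne unfolding right_diff_distrib [symmetric] by simp
      ultimately show ?thesis by (intro bexI[of _ "(0, a / (snd x - snd y))"]) auto
    qed
  qed (use K in \<open>auto simp: finite_subfield_def\<close>)
  then show ?thesis by (simp add: card_cartesian_product power2_eq_square)
qed

text \<open>
  The hypothesis \<open>card H \<le> (card F)\<^sup>2\<close> embeds \<open>H\<close> into the columns \<open>F \<times> F\<close>, and \<open>card F + 2 \<le> card H\<close>
  makes the degrees \<open>card H\<close> and \<open>(card F)\<^sup>2\<close> of the two kinds of points add up to at most
  \<open>card F * card H\<close>.
\<close>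

lemma square_le_max_semiintersecting_fields:
  fixes F :: "'a::field set" and H :: "'b::field set"
  assumes F: "finite_subfield F" and H: "finite_subfield H"
    and FH: "card F + 2 \<le> card H" and HF: "card H \<le> (card F)\<^sup>2" and k: "card F * card H \<le> k"
  shows "(card F * card H)\<^sup>2 \<le> max_semiintersecting k (k\<^sup>2)"
proof -
  have fin: "finite F" "finite H" "F \<noteq> {}" "H \<noteq> {}" using F H by (auto simp: finite_subfield_def)
  obtain i where i: "inj_on i F" "i ` F \<subseteq> H"
    using card_le_inj[of F H] fin FH by auto
  obtain j where j: "inj_on j H" "j ` H \<subseteq> F \<times> F"
    using card_le_inj[of H "F \<times> F"] fin HF by (auto simp: card_cartesian_product power2_eq_square)
  have "{0, 1} \<subseteq> F" using F by (auto simp: finite_subfield_def)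
  then have "card {0, 1 :: 'a} \<le> card F" using fin by (intro card_mono)
  then have "2 \<le> card F" by simp
  then obtain u where u: "card F = u + 2" by (metis add.commute le_Suc_ex)
  have "card H + (card F)\<^sup>2 \<le> card F * card H"
  proof -
    obtain w where w: "card H = u + 4 + w" using FH u by (metis add.assoc add.commute le_Suc_ex numeral_Bit0)
    show ?thesis unfolding w u by (simp add: power2_eq_square algebra_simps)
  qed
  then have "card H + (card F)\<^sup>2 \<le> k" using k by simp
  then show ?thesis
    using fin k by (intro square_le_max_semiintersecting[OF _ _ covering_array_line[OF F] covering_array_line[OF H]
      covering_array_columns[OF covering_array_line[OF H] i]
      covering_array_columns[OF covering_array_plane[OF F] j]]) (auto simp: card_gt_0_iff)
qed

section \<open>Fields of order $2^n$ and $3^n$\<close>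

text \<open>
  The roots of \<open>X ^ q - X\<close>. They are closed under addition because raising to the power \<open>q\<close> is
  additive, and there are \<open>q\<close> of them because the derivative of the polynomial is \<open>- 1\<close>, so that no
  root is repeated.
\<close>

lemma exists_finite_subfield:
  assumes p: "Factorial_Ring.prime CHAR('a::alg_closed_field)" and "n > 0"
  shows "\<exists>K :: 'a set. finite_subfield K \<and> card K = CHAR('a) ^ n"
proof -
  define q where "q = CHAR('a) ^ n"
  have q1: "q > 1" unfolding q_def using \<open>n > 0\<close> prime_gt_1_nat[OF p] by (intro one_less_power)
  have q0: "of_nat q = (0 :: 'a)" using \<open>n > 0\<close> by (simp add: q_def)
  define f :: "'a poly" where "f = monom 1 q - monom 1 1"
  define K where "K = {x :: 'a. x ^ q = x}"
  have root: "poly f x = 0 \<longleftrightarrow> x \<in> K" for x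
    by (simp add: f_def K_def poly_monom)
  have deg: "degree f = q"
    unfolding f_def diff_conv_add_uminus using q1 by (subst degree_add_eq_left) (auto simp: degree_monom_eq)
  then have f0: "f \<noteq> 0" using q1 by auto
  have der: "pderiv f = [:-1:]"
    by (simp add: f_def pderiv_diff pderiv_monom q0 one_pCons monom_0)
  obtain A where A: "size A = q" "f = smult (lead_coeff f) (\<Prod>x\<in>#A. [:-x, 1:])"
    using alg_closed_imp_factorization[OF f0] deg by auto
  \<comment> \<open>A repeated factor of \<open>f\<close> would divide its derivative.\<close>
  have le1: "count A x \<le> 1" for x
  proof (rule ccontr)
    assume "\<not> count A x \<le> 1"
    then have "replicate_mset 2 x \<subseteq># A" by (simp add: count_le_replicate_mset_subset_eq [symmetric])
    then obtain B where "A = replicate_mset 2 x + B"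
      unfolding mset_subset_eq_exists_conv by blast
    then have B: "A = add_mset x (add_mset x B)" by (simp add: numeral_2_eq_2)
    have "f = [:-x, 1:] * ([:-x, 1:] * smult (lead_coeff f) (\<Prod>x\<in>#B. [:-x, 1:]))"
      using A(2) B by (simp add: mult_ac)
    then obtain g where g: "f = [:-x, 1:] * ([:-x, 1:] * g)" by blast
    then have "poly (pderiv f) x = 0" unfolding g pderiv_mult poly_add poly_mult by simp
    then show False unfolding der by simp
  qed
  have "x \<in># A \<longleftrightarrow> x \<in> K" for x
  proof -
    have "poly f x = 0 \<longleftrightarrow> poly (\<Prod>x\<in>#A. [:-x, 1:]) x = 0"
      using f0 by (subst A(2)) simp
    also have "\<dots> \<longleftrightarrow> x \<in># A" by (auto simp: poly_prod_mset)
    finally show ?thesis using root by simp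
  qed
  then have K: "K = set_mset A" by auto
  have "count A x = 1" if "x \<in># A" for x
    using le1[of x] that by (metis count_greater_eq_one_iff le_antisym)
  then have card: "card K = q"
    using A(1) unfolding K by (simp add: size_multiset_overloaded_eq)
  have "finite K" unfolding K by simp
  have dream: "(x + y) ^ q = x ^ q + y ^ q" for x y :: 'a
    using freshmans_dream'[OF p q_def] .
  have diff: "(x - y) ^ q = x ^ q - y ^ q" for x y :: 'a
    using dream[of "x - y" y] by (simp add: algebra_simps)
  have "finite_subfield K"
    unfolding finite_subfield_def
    using \<open>finite K\<close> q1 by (auto simp: K_def dream diff power_mult_distrib power_divide)
  then show ?thesis using card q_def by auto
qed

lemma CHAR_eq_prime_card:
  assumes "card (UNIV :: 'a::field set) = p" "Factorial_Ring.prime p"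
  shows "CHAR('a) = p"
proof -
  have "CHAR('a) dvd p" using CHAR_dvd_CARD[where ?'a = 'a] assms(1) by simp
  then show ?thesis using assms(2) CHAR_not_1[where ?'a = 'a] by (auto simp: prime_nat_iff)
qed

lemma exists_finite_subfield_2:
  assumes "n > 0"
  shows "\<exists>K :: Enum.finite_2 alg_closure set. finite_subfield K \<and> card K = 2 ^ n"
proof -
  have "card (UNIV :: Enum.finite_2 set) = 2" by (simp add: UNIV_finite_2)
  then have "CHAR(Enum.finite_2) = 2" by (rule CHAR_eq_prime_card) simp
  then show ?thesis using exists_finite_subfield[where ?'a = "Enum.finite_2 alg_closure", of n] assms by simp
qed

lemma exists_finite_subfield_3:
  assumes "n > 0"
  shows "\<exists>K :: Enum.finite_3 alg_closure set. finite_subfield K \<and> card K = 3 ^ n"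
proof -
  have "card (UNIV :: Enum.finite_3 set) = 3" by (simp add: UNIV_finite_3)
  then have "CHAR(Enum.finite_3) = 3" by (rule CHAR_eq_prime_card) simp
  then show ?thesis using exists_finite_subfield[where ?'a = "Enum.finite_3 alg_closure", of n] assms by simp
qed

section \<open>Products of powers of 2 and 3\<close>

lemma log_2_3_bounds: "3 / 2 < log 2 (3::real)" "log 2 (3::real) < 8 / 5"
proof -
  have "log 2 (2 ^ 3) < log 2 ((3::real) ^ 2)" by (subst log_less_cancel_iff) auto
  then show "3 / 2 < log 2 (3::real)" by (subst (asm) (1 2) log_nat_power) auto
  have "log 2 (3 ^ 5) < log 2 ((2::real) ^ 8)" by (subst log_less_cancel_iff) auto
  then show "log 2 (3::real) < 8 / 5" by (subst (asm) (1 2) log_nat_power) auto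
qed

lemma power_3_eq_powr: "real (3 ^ n) = 2 powr (real n * log 2 3)"
proof -
  have "2 powr (log 2 3 * real n) = (2 powr log 2 3) powr real n" by (simp only: powr_powr)
  also have "\<dots> = 3 ^ n" by (simp add: powr_realpow)
  finally show ?thesis by (simp add: mult.commute)
qed

lemma log_2_3_irrational: "log 2 (3::real) \<notin> \<rat>"
proof
  assume "log 2 (3::real) \<in> \<rat>"
  then obtain m n :: nat where n: "n \<noteq> 0" "\<bar>log 2 (3::real)\<bar> = real m / real n"
    by (auto elim: Rats_abs_nat_div_natE)
  then have "real n * log 2 3 = real m" using log_2_3_bounds by (simp add: field_simps)
  then have "real (3 ^ n) = 2 powr real m" using power_3_eq_powr[of n] by simp
  then have "real (3 ^ n) = real (2 ^ m)" by (simp add: powr_realpow)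
  then have eq: "(3::nat) ^ n = 2 ^ m" by linarith
  have "odd ((3::nat) ^ n)" by simp
  then have "m = 0" unfolding eq by simp
  then show False using eq n(1) by simp
qed

text \<open>
  Modulo 1, some positive multiple \<open>m * \<theta>\<close> is a nonzero \<open>\<eta>\<close> with \<open>\<bar>\<eta>\<bar> < \<delta>\<close>. Subtracting
  \<open>\<eta>\<close> repeatedly moves \<open>y\<close> in steps shorter than \<open>\<delta>\<close>, to the left or to the right
  depending on the sign of \<open>\<eta>\<close>, so that within \<open>1 / \<bar>\<eta>\<bar> + 1\<close> steps the fractional part gets
  below \<open>\<delta>\<close>. What matters later is that the bound \<open>M\<close> does not depend on \<open>y\<close>.
\<close>

lemma multiples_dense_mod_1:
  fixes \<theta> \<delta> :: real
  assumes "\<theta> \<notin> \<rat>" "\<delta> > 0"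
  shows "\<exists>M. \<forall>y. \<exists>n\<le>M. \<exists>z::int. 0 \<le> y - real n * \<theta> - z \<and> y - real n * \<theta> - z < \<delta>"
proof -
  obtain N :: nat where N: "N > 0" "1 / N < \<delta>"
    by (metis \<open>\<delta> > 0\<close> gr_zeroI inverse_eq_divide real_arch_inverse)
  obtain h k where k: "0 < k" and hk: "\<bar>of_int k * \<theta> - of_int h\<bar> < 1 / N"
    using Dirichlet_approx[OF N(1)] by metis
  define m where "m = nat k"
  define \<eta> where "\<eta> = real m * \<theta> - of_int h"
  have m: "of_int k = real m" "m > 0" using k by (auto simp: m_def)
  have \<eta>: "\<bar>\<eta>\<bar> < \<delta>" using hk N(2) unfolding \<eta>_def m(1) by linarith
  have "\<eta> \<noteq> 0"
  proof
    assume "\<eta> = 0"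
    then have "\<theta> = of_int h / of_nat m" using m(2) by (simp add: \<eta>_def field_simps)
    then show False using assms(1) by auto
  qed
  have step: "y - real (j * m) * \<theta> - real_of_int (z - int j * h) = y - z - real j * \<eta>" for y j z
    by (simp add: \<eta>_def algebra_simps)
  define J where "J = nat \<lceil>1 / \<bar>\<eta>\<bar>\<rceil>"
  have J: "1 / \<bar>\<eta>\<bar> \<le> real J" unfolding J_def by linarith
  have "\<exists>n\<le>J * m. \<exists>z::int. 0 \<le> y - real n * \<theta> - z \<and> y - real n * \<theta> - z < \<delta>" for y
  proof -
    have "\<exists>j\<le>J. \<exists>z::int. 0 \<le> y - z - real j * \<eta> \<and> y - z - real j * \<eta> < \<delta>"
    proof (cases "\<eta> > 0")
      case True
      define t where "t = frac y / \<eta>"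
      have t: "0 \<le> t" "t \<le> 1 / \<eta>" using True frac_ge_0[of y] frac_lt_1[of y]
        by (auto simp: t_def divide_right_mono less_imp_le)
      define j where "j = nat \<lfloor>t\<rfloor>"
      have "real j \<le> t" "t < real j + 1" using t unfolding j_def by linarith+
      then have "real j * \<eta> \<le> t * \<eta>" "t * \<eta> < (real j + 1) * \<eta>" using True by auto
      then have "real j * \<eta> \<le> frac y" "frac y < real j * \<eta> + \<eta>" using True by (auto simp: t_def algebra_simps)
      moreover have "j \<le> J" using \<open>real j \<le> t\<close> t J True by linarith
      ultimately show ?thesis using \<eta> by (intro exI[of _ j] exI[of _ "\<lfloor>y\<rfloor>"] conjI) (auto simp: frac_def)
    next
      case False
      then have neg: "- \<eta> > 0" using \<open>\<eta> \<noteq> 0\<close> by simp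
      define t where "t = (1 - frac y) / - \<eta>"
      have t: "0 \<le> t" "t \<le> 1 / - \<eta>" using neg frac_ge_0[of y] frac_lt_1[of y] unfolding t_def
        by (intro divide_nonneg_pos divide_right_mono; simp)+
      define j where "j = nat \<lceil>t\<rceil>"
      have j: "t \<le> real j" "real j < t + 1" using t unfolding j_def by linarith+
      then have "t * - \<eta> \<le> real j * - \<eta>" "real j * - \<eta> < (t + 1) * - \<eta>"
        using neg by (intro mult_right_mono mult_strict_right_mono; simp)+
      then have "1 - frac y \<le> real j * - \<eta>" "real j * - \<eta> < 1 - frac y + - \<eta>"
        using neg by (auto simp: t_def algebra_simps)
      moreover have "j \<le> J" using t(2) neg unfolding j_def J_def by (intro nat_mono ceiling_mono) auto
      ultimately show ?thesis using \<eta> neg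
        by (intro exI[of _ j] exI[of _ "\<lfloor>y\<rfloor> + 1"] conjI) (auto simp: frac_def)
    qed
    then obtain j z where "j \<le> J" "0 \<le> y - real_of_int z - real j * \<eta>" "y - real_of_int z - real j * \<eta> < \<delta>" by blast
    then show ?thesis unfolding step[symmetric]
      by (intro exI[of _ "j * m"] exI[of _ "z - int j * h"] conjI) auto
  qed
  then show ?thesis by blast
qed

text \<open>
  Let \<open>s = log 2 k\<close>. An exponent \<open>b\<close> near \<open>3 * s / 8\<close> gives \<open>3 ^ b\<close> about 60 percent of the bits of \<open>k\<close>
  and leaves 40 percent for \<open>2 ^ a\<close>, strictly inside the range from \<open>2 ^ a\<close> to \<open>(2 ^ a)\<^sup>2\<close> allowed for
  \<open>3 ^ b\<close>. The bounded correction of \<open>b\<close> that density requires does not leave this range when \<open>k\<close> is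
  large.
\<close>

lemma eventually_near_2_power_times_3_power:
  fixes \<epsilon> :: real
  assumes "\<epsilon> > 0"
  shows "eventually (\<lambda>k::nat. \<exists>a b. a > 0 \<and> b > 0 \<and> (2::nat) ^ a + 2 \<le> 3 ^ b \<and> (3::nat) ^ b \<le> (2 ^ a)\<^sup>2 \<and>
           2 ^ a * 3 ^ b \<le> k \<and> (1 - \<epsilon>) * real k \<le> real (2 ^ a * 3 ^ b)) sequentially"
proof -
  define \<theta> where "\<theta> = log 2 (3::real)"
  have \<theta>: "3 / 2 < \<theta>" "\<theta> < 8 / 5" using log_2_3_bounds by (auto simp: \<theta>_def)
  obtain M where M: "\<And>y. \<exists>n\<le>M. \<exists>z::int. 0 \<le> y - real n * \<theta> - z \<and> y - real n * \<theta> - z < \<epsilon>"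
    using multiples_dense_mod_1[OF log_2_3_irrational \<open>\<epsilon> > 0\<close>] unfolding \<theta>_def by blast
  \<comment> \<open>The threshold is generous: 32 serves \<open>2 * 2 ^ a \<le> 3 ^ b\<close>,
      the other terms serve \<open>3 ^ b \<le> (2 ^ a)\<^sup>2\<close>.\<close>
  have "eventually (\<lambda>k::nat. log 2 (real k) \<ge> 32 + 24 * real M + 10 * \<epsilon>) sequentially"
    by real_asymp
  then show ?thesis using eventually_gt_at_top[of 0]
  proof eventually_elim
    case (elim k)
    define s where "s = log 2 (real k)"
    define b\<^sub>0 where "b\<^sub>0 = nat \<lfloor>3 * s / 8\<rfloor>"
    have s: "s \<ge> 32 + 24 * real M + 10 * \<epsilon>" using elim by (simp add: s_def)
    have b0: "real b\<^sub>0 \<le> 3 * s / 8" "3 * s / 8 - 1 \<le> real b\<^sub>0"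
      unfolding b\<^sub>0_def using s \<open>\<epsilon> > 0\<close> by linarith+
    obtain n and z :: int where n: "n \<le> M" "0 \<le> (s - real b\<^sub>0 * \<theta>) - real n * \<theta> - z"
        "(s - real b\<^sub>0 * \<theta>) - real n * \<theta> - z < \<epsilon>"
      using M[of "s - real b\<^sub>0 * \<theta>"] by blast
    define b where "b = b\<^sub>0 + n"
    have z: "z + real b * \<theta> \<le> s" "s - \<epsilon> < z + real b * \<theta>" using n by (auto simp: b_def algebra_simps)
    have b: "3 * s / 8 - 1 \<le> real b" "real b \<le> 3 * s / 8 + real M" using b0 n(1) by (auto simp: b_def)
    have b_pos: "b > 0" using b(1) s \<open>\<epsilon> > 0\<close> by (cases b) auto
    have "real b * \<theta> \<le> real b * (8 / 5)" "real b * (3 / 2) \<le> real b * \<theta>" using \<theta> by (intro mult_left_mono; simp)+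
    then have b\<theta>: "real b * \<theta> \<le> 3 * s / 5 + 8 / 5 * real M" "9 * s / 16 - 3 / 2 \<le> real b * \<theta>" using b by auto
    have "real_of_int z > 0" using z b\<theta> s \<open>\<epsilon> > 0\<close> by linarith
    define a where "a = nat z"
    have a: "real_of_int z = real a" "a > 0" using \<open>real_of_int z > 0\<close> by (auto simp: a_def)
    have p3: "real (3 ^ b) = 2 powr (real b * \<theta>)"
      unfolding \<theta>_def by (rule power_3_eq_powr)
    have p2: "real (2 ^ a) = 2 powr real a" for a by (simp add: powr_realpow)
    have p23: "real (2 ^ a * 3 ^ b) = 2 powr (real a + real b * \<theta>)"
      unfolding of_nat_mult p2 p3 powr_add ..
    have k: "real k = 2 powr s" using elim by (simp add: s_def)
    have "real (2 ^ (a + 1)) \<le> real (3 ^ b)"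
      unfolding p2 p3 using z b\<theta> s a \<open>\<epsilon> > 0\<close> by (intro powr_mono) auto
    then have "(2::nat) ^ (a + 1) \<le> 3 ^ b" by linarith
    moreover have "(2::nat) ^ 1 \<le> 2 ^ a" using a by (intro power_increasing) auto
    ultimately have 1: "(2::nat) ^ a + 2 \<le> 3 ^ b" by simp
    have "real (3 ^ b) \<le> real (2 ^ (a * 2))"
      unfolding p2 p3 using z b\<theta> s a by (intro powr_mono) auto
    then have 2: "(3::nat) ^ b \<le> (2 ^ a)\<^sup>2" unfolding power_mult [symmetric] by linarith
    have "real (2 ^ a * 3 ^ b) \<le> real k"
      unfolding p23 k using z a by (intro powr_mono) auto
    then have 3: "2 ^ a * 3 ^ b \<le> k" by linarith
    have "ln 2 * \<epsilon> \<le> 1 * \<epsilon>" using \<open>\<epsilon> > 0\<close> ln_2_less_1 by (intro mult_right_mono) auto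
    then have "1 - \<epsilon> \<le> 1 + (- \<epsilon>) * ln 2" by (simp add: mult.commute)
    also have "\<dots> \<le> 2 powr (- \<epsilon>)" unfolding powr_def using exp_ge_add_one_self[of "- \<epsilon> * ln 2"] by simp
    finally have "(1 - \<epsilon>) * real k \<le> 2 powr (- \<epsilon>) * 2 powr s" unfolding k by (intro mult_right_mono) auto
    also have "\<dots> = 2 powr (s - \<epsilon>)" by (simp add: powr_add [symmetric])
    also have "\<dots> \<le> real (2 ^ a * 3 ^ b)" unfolding p23 using z a by (intro powr_mono) auto
    finally show ?case using 1 2 3 a b_pos by blast
  qed
qed

section \<open>The limit\<close>

lemma eventually_max_semiintersecting_ge:
  fixes \<epsilon> :: real
  assumes "0 < \<epsilon>" "\<epsilon> < 1"
  shows "eventually (\<lambda>k. (1 - \<epsilon>)\<^sup>2 * real (k\<^sup>2) \<le> real (max_semiintersecting k (k\<^sup>2))) sequentially"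
  using eventually_near_2_power_times_3_power[OF assms(1)]
proof eventually_elim
  case (elim k)
  then obtain a b where ab: "a > 0" "b > 0" "(2::nat) ^ a + 2 \<le> 3 ^ b" "(3::nat) ^ b \<le> (2 ^ a)\<^sup>2"
    "2 ^ a * 3 ^ b \<le> k" "(1 - \<epsilon>) * real k \<le> real (2 ^ a * 3 ^ b)"
    by blast
  obtain F :: "Enum.finite_2 alg_closure set" where F: "finite_subfield F" "card F = 2 ^ a"
    using exists_finite_subfield_2[OF ab(1)] by blast
  obtain H :: "Enum.finite_3 alg_closure set" where H: "finite_subfield H" "card H = 3 ^ b"
    using exists_finite_subfield_3[OF ab(2)] by blast
  have "((1 - \<epsilon>) * real k)\<^sup>2 \<le> (real (2 ^ a * 3 ^ b))\<^sup>2"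
    by (rule power_mono[OF ab(6)]) (use assms in simp)
  also have "\<dots> = real ((2 ^ a * 3 ^ b)\<^sup>2)" by (simp only: of_nat_power)
  also have "\<dots> \<le> real (max_semiintersecting k (k\<^sup>2))"
    unfolding of_nat_le_iff
    by (rule square_le_max_semiintersecting_fields[OF F(1) H(1), unfolded F(2) H(2), OF ab(3-5)])
  finally show ?case by (simp only: power_mult_distrib of_nat_power)
qed

theorem corollary3p12:
  "(\<lambda>k::nat. real (max_semiintersecting k (k\<^sup>2)) / real (k\<^sup>2)) \<longlonglongrightarrow> 1"
proof (rule order_tendstoI)
  fix c :: real assume "c < 1"
  obtain \<epsilon> where \<epsilon>: "0 < \<epsilon>" "\<epsilon> < 1" "2 * \<epsilon> < 1 - c"
    using field_lbound_gt_zero[of 1 "(1 - c) / 2"] \<open>c < 1\<close> by (auto simp: field_simps)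
  have "1 - 2 * \<epsilon> \<le> (1 - \<epsilon>)\<^sup>2" by (simp add: power2_diff)
  then have c: "c < (1 - \<epsilon>)\<^sup>2" using \<epsilon>(3) by linarith
  show "eventually (\<lambda>k. c < real (max_semiintersecting k (k\<^sup>2)) / real (k\<^sup>2)) sequentially"
    using eventually_max_semiintersecting_ge[OF \<epsilon>(1,2)] eventually_gt_at_top[of 0]
  proof eventually_elim
    case (elim k)
    then have "(1 - \<epsilon>)\<^sup>2 \<le> real (max_semiintersecting k (k\<^sup>2)) / real (k\<^sup>2)" by (simp add: pos_le_divide_eq)
    then show ?case using c by linarith
  qed
next
  fix c :: real assume "1 < c"
  show "eventually (\<lambda>k. real (max_semiintersecting k (k\<^sup>2)) / real (k\<^sup>2) < c) sequentially"
    using eventually_gt_at_top[of 0]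
  proof eventually_elim
    case (elim k)
    have "real (max_semiintersecting k (k\<^sup>2)) \<le> real (k\<^sup>2)"
      using max_semiintersecting_le[OF elim] by (simp only: of_nat_le_iff)
    then have "real (max_semiintersecting k (k\<^sup>2)) / real (k\<^sup>2) \<le> 1" using elim by (simp add: divide_le_eq_1)
    then show ?case using \<open>1 < c\<close> by linarith
  qed
qed

end
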